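(* Let $H$ be a real Hilbert space of square-integrable real-valued functions on $[0,1]$, and let $\mathcal{H}$ be a functional reproducing kernel Hilbert space of maps $H\to H$ with reproducing kernel $K$. Let $(x_1,y_1),\ldots,(x_n,y_n)\in H\times H$ be given observations, and let $\lambda>0$. Then the solution $\hat F$ to the minimization problem $$\min_{F\in\mathcal{H}}\ \sum_{i=1}^n\|y_i-F(x_i)\|_2^2+\lambda\|F\|_{\mathcal{H}}^2$$ has the representation $$\hat F=\sum_{i=1}^n K(x_i,\cdot)\alpha_i$$ with functional coefficients $\alpha_1,\ldots,\alpha_n\in H$.
   Context: Here $\|f\|_2^2=\int_0^1 f(t)^2\,dt$, and $\langle\cdot,\cdot\rangle_H$ is the inner product of $H$. A functional reproducing kernel Hilbert space $\mathcal{H}$ is a linear space of maps $F:H\to H$ (not necessarily linear maps, with pointwise operations) which is a Hilbert space with an inner product $\langle\cdot,\cdot\rangle_{\mathcal{H}}$ and norm $\|\cdot\|_{\mathcal{H}}$, such that for every $x\in H$ the point evaluation $F\mapsto F(x)$ is a bounded linear operator from $\mathcal{H}$ to $H$. By the Riesz representation theorem, for all $x,g\in H$ there is a unique $K_x^g\in\mathcal{H}$ with $\langle K_x^g,F\rangle_{\mathcal{H}}=\langle F(x),g\rangle_H$ for all $F\in\mathcal{H}$. For $x,y\in H$ the map $g\mapsto K_x^g(y)$ is a bounded linear operator on $H$, denoted $K(x,y)$, so that $K(x,y)g=K_x^g(y)$. The map $K$ is called the reproducing kernel of $\mathcal{H}$. For $x,\alpha\in H$, $K(x,\cdot)\alpha$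 denotes the element $K_x^\alpha$ of $\mathcal{H}$, i.e. the map $y\mapsto K(x,y)\alpha$.
   Formalization: The inclusion of H into L²[0,1] is assumed continuous (‖f‖₂ ≤ C‖f‖_H for some C); for a Hilbert space of square-integrable functions whose norm does not control the L² norm the representation can fail. *)

theory Defs
  imports "HOL-Analysis.Analysis"
begin

definition square_integrable :: "(real \<Rightarrow> real) \<Rightarrow> bool" where
  "square_integrable f \<longleftrightarrow>
     f \<in> borel_measurable (lebesgue_on {0..1}) \<and> integrable (lebesgue_on {0..1}) (\<lambda>t. (f t)\<^sup>2)"

definition L2_norm :: "(real \<Rightarrow> real) \<Rightarrow> real" where
  "L2_norm f = sqrt (\<integral>t. (f t)\<^sup>2 \<partial>lebesgue_on {0..1})"

text \<open>
  A Hilbert space \<open>H\<close> of square-integrable functions on \<open>[0,1]\<close> is a complete inner product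
  space \<open>'h\<close> together with a map \<open>rep\<close> sending each element to the function it stands for.
  For a space of genuine functions \<open>rep\<close> is the inclusion; for a space of classes modulo
  almost-everywhere equality, such as \<open>L\<^sup>2[0,1]\<close>, it is any choice of representatives. For this
  reason the vector operations are the pointwise ones only almost everywhere. Values of
  \<open>rep f\<close> outside the unit interval are immaterial, hence the restriction in the first axiom.

  The inner product of \<open>'h\<close> need not be the one of \<open>L\<^sup>2\<close>; the inclusion into \<open>L\<^sup>2\<close> is only
  required to be continuous, as for closed subspaces of \<open>L\<^sup>2\<close> (with \<open>C = 1\<close>), Sobolev spaces,
  and so on. Without continuity the representer theorem fails.
\<close>

locale L2_function_space =
  fixes rep :: "'h::{real_inner, complete_space} \<Rightarrow> real \<Rightarrow> real"
  assumes rep_inj: "inj (\<lambda>f. restrict (rep f) {0..1})"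
    and rep_square_integrable: "square_integrable (rep f)"
    and rep_add: "AE t in lebesgue_on {0..1}. rep (f + g) t = rep f t + rep g t"
    and rep_scaleR: "AE t in lebesgue_on {0..1}. rep (c *\<^sub>R f) t = c * rep f t"
    and rep_continuous: "\<exists>C. \<forall>f. L2_norm (rep f) \<le> C * norm f"

text \<open>
  The space is a set \<open>V\<close> of maps with inner product \<open>ip\<close>, whose values off \<open>V\<close> are
  irrelevant. Linearity of the point evaluations is automatic, the operations being pointwise.
\<close>

locale functional_rkhs =
  fixes V :: "('h::{real_inner, complete_space} \<Rightarrow> 'h) set"
    and ip :: "('h \<Rightarrow> 'h) \<Rightarrow> ('h \<Rightarrow> 'h) \<Rightarrow> real"
  assumes zero_mem: "(\<lambda>x. 0) \<in> V"
    and add_mem: "F \<in> V \<Longrightarrow> G \<in> V \<Longrightarrow> (\<lambda>x. F x + G x) \<in> V"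
    and scaleR_mem: "F \<in> V \<Longrightarrow> (\<lambda>x. c *\<^sub>R F x) \<in> V"
    and ip_commute: "F \<in> V \<Longrightarrow> G \<in> V \<Longrightarrow> ip F G = ip G F"
    and ip_add_left:
      "F \<in> V \<Longrightarrow> G \<in> V \<Longrightarrow> E \<in> V \<Longrightarrow> ip (\<lambda>x. F x + G x) E = ip F E + ip G E"
    and ip_scaleR_left: "F \<in> V \<Longrightarrow> G \<in> V \<Longrightarrow> ip (\<lambda>x. c *\<^sub>R F x) G = c * ip F G"
    and ip_nonneg: "F \<in> V \<Longrightarrow> 0 \<le> ip F F"
    and ip_eq_zero: "F \<in> V \<Longrightarrow> ip F F = 0 \<Longrightarrow> F = (\<lambda>x. 0)"
    and complete:
      "(\<And>k. X k \<in> V) \<Longrightarrow>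
       (\<And>e. 0 < e \<Longrightarrow> \<exists>N. \<forall>j\<ge>N. \<forall>k\<ge>N. sqrt (ip (\<lambda>x. X j x - X k x) (\<lambda>x. X j x - X k x)) < e) \<Longrightarrow>
       \<exists>F\<in>V. (\<lambda>k. sqrt (ip (\<lambda>x. X k x - F x) (\<lambda>x. X k x - F x))) \<longlonglongrightarrow> 0"
    and eval_bounded: "\<exists>C. \<forall>F\<in>V. norm (F x) \<le> C * sqrt (ip F F)"

definition eval_representer ::
  "('h::real_inner \<Rightarrow> 'h) set \<Rightarrow> (('h \<Rightarrow> 'h) \<Rightarrow> ('h \<Rightarrow> 'h) \<Rightarrow> real) \<Rightarrow> 'h \<Rightarrow> 'h \<Rightarrow> 'h \<Rightarrow> 'h" where
  "eval_representer V ip x g = (THE R. R \<in> V \<and> (\<forall>F\<in>V. ip R F = F x \<bullet> g))"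

definition reproducing_kernel ::
  "('h::real_inner \<Rightarrow> 'h) set \<Rightarrow> (('h \<Rightarrow> 'h) \<Rightarrow> ('h \<Rightarrow> 'h) \<Rightarrow> real) \<Rightarrow> 'h \<Rightarrow> 'h \<Rightarrow> 'h \<Rightarrow> 'h" where
  "reproducing_kernel V ip x y = (\<lambda>g. eval_representer V ip x g y)"

definition objective ::
  "('h::real_inner \<Rightarrow> real \<Rightarrow> real) \<Rightarrow> (('h \<Rightarrow> 'h) \<Rightarrow> ('h \<Rightarrow> 'h) \<Rightarrow> real) \<Rightarrow>
   nat \<Rightarrow> (nat \<Rightarrow> 'h) \<Rightarrow> (nat \<Rightarrow> 'h) \<Rightarrow> real \<Rightarrow> ('h \<Rightarrow> 'h) \<Rightarrow> real" where
  "objective rep ip n x y lam F =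
     (\<Sum>i=1..n. (L2_norm (rep (y i - F (x i))))\<^sup>2) + lam * (sqrt (ip F F))\<^sup>2"

end

theory Submission
  imports Defs
begin

text \<open>
  Write \<open>B\<close> for the \<open>L\<^sup>2\<close> form on \<open>H\<close>, which is bounded by continuity of the inclusion. The
  objective is, up to a constant, \<open>[F, F] - 2 \<Sum> B y\<^sub>i (F x\<^sub>i)\<close> with
  \<open>[F, G] = \<Sum> B (F x\<^sub>i) (G x\<^sub>i) + \<lambda> \<langle>F, G\<rangle>\<close>, an inner product equivalent to the given one.
  Its unique minimizer is therefore the Riesz representer of \<open>G \<mapsto> \<Sum> B y\<^sub>i (G x\<^sub>i)\<close>
  with respect to \<open>[\<cdot>, \<cdot>]\<close>, that is, \<open>\<lambda> \<langle>F, G\<rangle> = \<Sum> B (y\<^sub>i - F x\<^sub>i) (G x\<^sub>i)\<close> for all \<open>G\<close>.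
  Representing each functional \<open>B (y\<^sub>i - F x\<^sub>i)\<close> by an element \<open>\<lambda> \<alpha>\<^sub>i\<close> of \<open>H\<close> turns the right-hand
  side into \<open>\<lambda> \<langle>\<Sum> K(x\<^sub>i, \<cdot>) \<alpha>\<^sub>i, G\<rangle>\<close>.
\<close>

text \<open>Source of every Cauchy-Schwarz type bound below: it is applied to a nonnegative quantity
  along a line, as a polynomial in the parameter \<open>t\<close>.\<close>

lemma nonneg_quadratic_discriminant:
  fixes a b c :: real
  assumes "0 \<le> a" and nonneg: "\<And>t. 0 \<le> a * t\<^sup>2 + 2 * b * t + c"
  shows "b\<^sup>2 \<le> a * c"
proof (cases "a = 0")
  case True
  have "b = 0"
  proof (rule ccontr)
    assume "b \<noteq> 0"
    \<comment> \<open>With \<open>a = 0\<close>, this \<open>t\<close> makes the remaining affine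
      function equal to \<open>- 1\<close>.\<close>
    with nonneg[of "- (c + 1) / (2 * b)"] True show False by simp
  qed
  with True show ?thesis by simp
next
  case False
  with \<open>0 \<le> a\<close> have "0 < a" by simp
  with nonneg[of "- b / a"] have "0 \<le> c - b\<^sup>2 / a"
    by (simp add: power2_eq_square field_simps)
  with \<open>0 < a\<close> show ?thesis by (simp add: field_simps)
qed

section \<open>Inner product calculus and Riesz representation in a functional RKHS\<close>

context functional_rkhs
begin

lemma add_scaleR_mem: "F \<in> V \<Longrightarrow> G \<in> V \<Longrightarrow> (\<lambda>x. F x + c *\<^sub>R G x) \<in> V"
  by (intro add_mem scaleR_mem)

lemma diff_mem: "F \<in> V \<Longrightarrow> G \<in> V \<Longrightarrow> (\<lambda>x. F x - G x) \<in> V"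
  using add_scaleR_mem[of F G "- 1"] by simp

lemma ip_add_scaleR_left:
  "F \<in> V \<Longrightarrow> G \<in> V \<Longrightarrow> E \<in> V \<Longrightarrow> ip (\<lambda>x. F x + c *\<^sub>R G x) E = ip F E + c * ip G E"
  by (simp add: ip_add_left ip_scaleR_left scaleR_mem)

lemma ip_diff_left:
  "F \<in> V \<Longrightarrow> G \<in> V \<Longrightarrow> E \<in> V \<Longrightarrow> ip (\<lambda>x. F x - G x) E = ip F E - ip G E"
  using ip_add_scaleR_left[of F G E "- 1"] by simp

lemma ip_zero_left: "E \<in> V \<Longrightarrow> ip (\<lambda>x. 0) E = 0"
  using ip_scaleR_left[of "\<lambda>x. 0" E 0] by (simp add: zero_mem)

lemma ip_add_scaleR_self:
  assumes "F \<in> V" "G \<in> V"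
  shows "ip (\<lambda>x. F x + c *\<^sub>R G x) (\<lambda>x. F x + c *\<^sub>R G x)
         = ip G G * c\<^sup>2 + 2 * ip F G * c + ip F F"
proof -
  let ?S = "\<lambda>x. F x + c *\<^sub>R G x"
  have "?S \<in> V" using assms by (rule add_scaleR_mem)
  then have "ip ?S ?S = ip ?S F + c * ip ?S G"
    using assms by (simp add: ip_add_scaleR_left ip_commute[of _ ?S])
  then show ?thesis
    using assms by (simp add: ip_add_scaleR_left ip_commute[of G F] power2_eq_square algebra_simps)
qed

lemma ip_diff_self:
  assumes "F \<in> V" "G \<in> V"
  shows "ip (\<lambda>x. F x - G x) (\<lambda>x. F x - G x) = ip F F - 2 * ip G F + ip G G"
  using ip_add_scaleR_self[OF assms, of "- 1"] ip_commute[OF assms] by simp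

lemma ip_Cauchy_Schwarz:
  assumes "F \<in> V" "G \<in> V"
  shows "\<bar>ip F G\<bar> \<le> sqrt (ip F F) * sqrt (ip G G)"
proof -
  have "0 \<le> ip G G * t\<^sup>2 + 2 * ip F G * t + ip F F" for t
    using ip_nonneg[OF add_scaleR_mem[OF assms]] ip_add_scaleR_self[OF assms] by simp
  then have "(ip F G)\<^sup>2 \<le> ip G G * ip F F"
    using nonneg_quadratic_discriminant ip_nonneg assms by blast
  then show ?thesis
    by (metis mult.commute real_sqrt_abs real_sqrt_le_iff real_sqrt_mult)
qed

text \<open>Testing against \<open>F - G\<close> itself shows that it has norm zero. This yields
  uniqueness of representers.\<close>

lemma ip_ext:
  assumes "F \<in> V" "G \<in> V" and eq: "\<And>E. E \<in> V \<Longrightarrow> ip F E = ip G E"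
  shows "F = G"
proof -
  have "ip (\<lambda>x. F x - G x) (\<lambda>x. F x - G x) = 0"
    using assms by (simp add: ip_diff_left diff_mem)
  then have "(\<lambda>x. F x - G x) = (\<lambda>x. 0)"
    using assms by (intro ip_eq_zero diff_mem)
  then show ?thesis by (metis eq_iff_diff_eq_0 ext)
qed

lemma sum_mem:
  assumes "finite A" "\<And>i. i \<in> A \<Longrightarrow> G i \<in> V"
  shows "(\<lambda>x. \<Sum>i\<in>A. G i x) \<in> V"
  using assms by (induction A) (simp_all add: zero_mem add_mem)

lemma ip_sum_left:
  assumes "finite A" "\<And>i. i \<in> A \<Longrightarrow> G i \<in> V" "E \<in> V"
  shows "ip (\<lambda>x. \<Sum>i\<in>A. G i x) E = (\<Sum>i\<in>A. ip (G i) E)"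
  using assms by (induction A) (simp_all add: ip_zero_left ip_add_left sum_mem)

text \<open>
  Along a sequence minimizing \<open>ip F F - 2 * L F\<close>, nonnegativity of the excess over the infimum at
  \<open>X k + t G\<close> for all \<open>t\<close> bounds \<open>ip (X k) G - L G\<close>. This one bound shows both that the sequence
  is Cauchy and that its limit represents \<open>L\<close>.
\<close>
lemma Riesz_representation:
  fixes L :: "('h \<Rightarrow> 'h) \<Rightarrow> real"
  assumes L_add: "\<And>F G. F \<in> V \<Longrightarrow> G \<in> V \<Longrightarrow> L (\<lambda>x. F x + G x) = L F + L G"
    and L_scaleR: "\<And>F c. F \<in> V \<Longrightarrow> L (\<lambda>x. c *\<^sub>R F x) = c * L F"
    and L_bounded: "\<And>F. F \<in> V \<Longrightarrow> \<bar>L F\<bar> \<le> C * sqrt (ip F F)"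
  obtains R where "R \<in> V" "\<And>F. F \<in> V \<Longrightarrow> ip R F = L F"
proof -
  define J where "J F = ip F F - 2 * L F" for F
  have L_add_scaleR: "L (\<lambda>x. F x + c *\<^sub>R G x) = L F + c * L G" if "F \<in> V" "G \<in> V" for F G c
    using that by (simp add: L_add L_scaleR scaleR_mem)
  have J_lower: "- C\<^sup>2 \<le> J F" if "F \<in> V" for F
  proof -
    \<comment> \<open>Completing the square: \<open>ip F F - 2 * C * sqrt (ip F F)\<close> is at
      least \<open>- C\<^sup>2\<close>, so the infimum of \<open>J\<close> is finite.\<close>
    have "0 \<le> (sqrt (ip F F) - C)\<^sup>2" by simp
    then have "0 \<le> ip F F - 2 * (C * sqrt (ip F F)) + C\<^sup>2"
      using ip_nonneg[OF that] by (simp add: power2_diff algebra_simps)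
    with L_bounded[OF that] show ?thesis unfolding J_def by linarith
  qed
  define m where "m = (INF F\<in>V. J F)"
  have bdd: "bdd_below (J ` V)" using J_lower by (meson bdd_belowI2)
  have m_le: "m \<le> J F" if "F \<in> V" for F
    unfolding m_def using bdd that by (rule cINF_lower)
  \<comment> \<open>\<open>Suc k\<close> keeps the tolerance positive at \<open>k = 0\<close>. The
    zero map makes \<open>V\<close> nonempty, as the infimum requires.\<close>
  have "\<exists>F\<in>V. J F < m + 1 / Suc k" for k
  proof (rule ccontr)
    assume "\<not> ?thesis"
    then have "m + 1 / Suc k \<le> m"
      unfolding m_def using zero_mem by (intro cINF_greatest) (auto simp: not_less)
    then show False by (simp add: field_simps)
  qed
  then obtain X where X_mem: "X k \<in> V" and X_J: "J (X k) < m + 1 / Suc k" for k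
    by metis
  define s where "s k = sqrt (1 / real (Suc k))" for k
  have "(\<lambda>k. sqrt (1 / real (Suc k))) \<longlonglongrightarrow> sqrt 0"
    using LIMSEQ_Suc[OF lim_1_over_n] by (intro tendsto_real_sqrt)
  then have s_lim: "s \<longlonglongrightarrow> 0"
    unfolding s_def by simp
  have near: "\<bar>ip (X k) G - L G\<bar> \<le> s k * sqrt (ip G G)" if G: "G \<in> V" for k G
  proof -
    \<comment> \<open>The first two terms are \<open>J (X k + t G) - J (X k)\<close>, which is at
      least \<open>m - J (X k)\<close>, and the latter exceeds \<open>- 1 / Suc k\<close>.\<close>
    have "0 \<le> ip G G * t\<^sup>2 + 2 * (ip (X k) G - L G) * t + 1 / Suc k" for t
      using m_le[OF add_scaleR_mem[OF X_mem G]] X_J[of k]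
      unfolding J_def ip_add_scaleR_self[OF X_mem G] L_add_scaleR[OF X_mem G]
      by (simp only: algebra_simps) (smt (verit))
    then have "(ip (X k) G - L G)\<^sup>2 \<le> ip G G * (1 / Suc k)"
      by (intro nonneg_quadratic_discriminant ip_nonneg G)
    then have "sqrt ((ip (X k) G - L G)\<^sup>2) \<le> sqrt (ip G G * (1 / Suc k))"
      by (rule real_sqrt_le_mono)
    then show ?thesis
      unfolding s_def real_sqrt_mult by (simp add: mult.commute)
  qed
  have dist_le: "sqrt (ip (\<lambda>x. X j x - X k x) (\<lambda>x. X j x - X k x)) \<le> s j + s k" for j k
  proof -
    define D where "D = (\<lambda>x. X j x - X k x)"
    have D: "D \<in> V" unfolding D_def by (intro diff_mem X_mem)
    have "ip D D = ip (X j) D - ip (X k) D"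
      using D by (subst (1) D_def) (simp add: ip_diff_left X_mem)
    \<comment> \<open>\<open>L D\<close> cancels when the defects of \<open>X j\<close> and
      \<open>X k\<close> at \<open>D\<close> are subtracted, so \<open>near\<close> bounds the
      difference.\<close>
    also have "\<dots> \<le> (s j + s k) * sqrt (ip D D)"
      using near[OF D, of j] near[OF D, of k] by (simp add: algebra_simps)
    finally have "sqrt (ip D D) * sqrt (ip D D) \<le> (s j + s k) * sqrt (ip D D)"
      using ip_nonneg[OF D] by simp
    moreover have "0 \<le> s j + s k" unfolding s_def by simp
    \<comment> \<open>One factor \<open>sqrt (ip D D)\<close> is cancelled; if it is zero,
      nonnegativity of \<open>s j + s k\<close> suffices.\<close>
    ultimately have "sqrt (ip D D) \<le> s j + s k"
      by (metis ip_nonneg[OF D] less_eq_real_def mult_right_le_imp_le real_sqrt_ge_zero)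
    then show ?thesis unfolding D_def .
  qed
  have "\<exists>F\<in>V. (\<lambda>k. sqrt (ip (\<lambda>x. X k x - F x) (\<lambda>x. X k x - F x))) \<longlonglongrightarrow> 0"
  proof (rule complete[OF X_mem])
    fix e :: real assume "0 < e"
    then have "\<forall>\<^sub>F k in sequentially. s k < e / 2"
      by (intro order_tendstoD(2)[OF s_lim]) simp
    then obtain N where N: "\<And>k. N \<le> k \<Longrightarrow> s k < e / 2"
      unfolding eventually_sequentially by blast
    have "sqrt (ip (\<lambda>x. X j x - X k x) (\<lambda>x. X j x - X k x)) < e" if "N \<le> j" "N \<le> k" for j k
      using dist_le[of j k] N[OF that(1)] N[OF that(2)] by simp
    then show "\<exists>N. \<forall>j\<ge>N. \<forall>k\<ge>N. sqrt (ip (\<lambda>x. X j x - X k x) (\<lambda>x. X j x - X k x)) < e"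
      by blast
  qed
  then obtain R where R: "R \<in> V"
    and R_lim: "(\<lambda>k. sqrt (ip (\<lambda>x. X k x - R x) (\<lambda>x. X k x - R x))) \<longlonglongrightarrow> 0"
    by blast
  have "ip R G = L G" if G: "G \<in> V" for G
  proof -
    let ?d = "\<lambda>k. sqrt (ip (\<lambda>x. X k x - R x) (\<lambda>x. X k x - R x))"
    \<comment> \<open>Split \<open>ip R G - L G\<close> as
      \<open>(ip (X k) G - L G) - ip (X k - R) G\<close>; \<open>near\<close> bounds the first part,
      Cauchy-Schwarz the second.\<close>
    have "\<bar>ip R G - L G\<bar> \<le> (?d k + s k) * sqrt (ip G G)" for k
      using near[OF G, of k] ip_Cauchy_Schwarz[OF diff_mem[OF X_mem R] G, of k]
      by (simp add: ip_diff_left X_mem R G distrib_right)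
    moreover have "(\<lambda>k. (?d k + s k) * sqrt (ip G G)) \<longlonglongrightarrow> (0 + 0) * sqrt (ip G G)"
      by (intro tendsto_mult tendsto_add R_lim s_lim tendsto_const)
    ultimately have "\<bar>ip R G - L G\<bar> \<le> 0"
      by (intro LIMSEQ_le_const[where X = "\<lambda>k. (?d k + s k) * sqrt (ip G G)"]) simp_all
    then show ?thesis by simp
  qed
  with R that show ?thesis by blast
qed

text \<open>Existence comes from Riesz representation of \<open>F \<mapsto> F x \<bullet> g\<close>,
  bounded because evaluation at \<open>x\<close> is, and uniqueness from \<open>ip_ext\<close>;
  together they justify the definite description in \<open>eval_representer\<close>.\<close>

lemma reproducing_kernel:
  shows reproducing_kernel_mem: "(\<lambda>z. reproducing_kernel V ip x z g) \<in> V"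
    and ip_reproducing_kernel: "F \<in> V \<Longrightarrow> ip (\<lambda>z. reproducing_kernel V ip x z g) F = F x \<bullet> g"
proof -
  obtain C where C: "\<forall>F\<in>V. norm (F x) \<le> C * sqrt (ip F F)"
    using eval_bounded by blast
  obtain R where R: "R \<in> V" "\<And>F. F \<in> V \<Longrightarrow> ip R F = F x \<bullet> g"
  proof (rule Riesz_representation[of "\<lambda>F. F x \<bullet> g" "C * norm g"])
    fix F assume "F \<in> V"
    then have "norm (F x) * norm g \<le> (C * sqrt (ip F F)) * norm g"
      using C by (intro mult_right_mono) auto
    then show "\<bar>F x \<bullet> g\<bar> \<le> C * norm g * sqrt (ip F F)"
      using Cauchy_Schwarz_ineq2[of "F x" g] by (simp add: mult_ac)
  qed (auto simp: inner_add_left)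
  have "eval_representer V ip x g = R"
    unfolding eval_representer_def using R by (intro the_equality) (auto intro: ip_ext)
  then have "(\<lambda>z. reproducing_kernel V ip x z g) = R"
    unfolding reproducing_kernel_def by simp
  with R show "(\<lambda>z. reproducing_kernel V ip x z g) \<in> V"
    and "F \<in> V \<Longrightarrow> ip (\<lambda>z. reproducing_kernel V ip x z g) F = F x \<bullet> g"
    by simp_all
qed

end

section \<open>Riesz representation in \<open>H\<close> itself\<close>

lemma functional_rkhs_constant_maps:
  "functional_rkhs (range (\<lambda>(a::'h::{real_inner, complete_space}) (x::'h). a)) (\<lambda>F G. F 0 \<bullet> G 0)"
proof
  fix X :: "nat \<Rightarrow> 'h \<Rightarrow> 'h"
  assume Cauchy: "\<And>e. 0 < e \<Longrightarrow>
      \<exists>N. \<forall>j\<ge>N. \<forall>k\<ge>N. sqrt ((X j 0 - X k 0) \<bullet> (X j 0 - X k 0)) < e"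
  have "Cauchy (\<lambda>k. X k 0)"
    unfolding Cauchy_def dist_norm norm_eq_sqrt_inner using Cauchy by blast
  then obtain a where "(\<lambda>k. X k 0) \<longlonglongrightarrow> a"
    using Cauchy_convergent_iff convergent_def by blast
  then have "(\<lambda>k. norm (X k 0 - a)) \<longlonglongrightarrow> 0"
    by (simp add: LIM_zero tendsto_norm_zero)
  then show "\<exists>F\<in>range (\<lambda>a x. a). (\<lambda>k. sqrt ((X k 0 - F 0) \<bullet> (X k 0 - F 0))) \<longlonglongrightarrow> 0"
    by (auto simp: norm_eq_sqrt_inner)
next
  fix x :: 'h
  show "\<exists>C. \<forall>F\<in>range (\<lambda>a x. a). norm (F x) \<le> C * sqrt (F 0 \<bullet> F 0)"
    by (rule exI[of _ 1]) (auto simp: norm_eq_sqrt_inner)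
qed (auto simp: inner_add_left image_iff intro: inner_commute)

text \<open>The constant maps are a copy of the Hilbert space \<open>'h\<close>, identified with it
  by the value at \<open>0\<close>, so the Riesz theorem for functional RKHS applies to
  \<open>F \<mapsto> l (F 0)\<close>.\<close>

lemma Riesz_representation_inner:
  fixes l :: "'h::{real_inner, complete_space} \<Rightarrow> real"
  assumes "bounded_linear l"
  obtains a where "\<And>h. l h = a \<bullet> h"
proof -
  interpret l: bounded_linear l by fact
  interpret functional_rkhs "range (\<lambda>(a::'h) (x::'h). a)" "\<lambda>F G. F 0 \<bullet> G 0"
    by (rule functional_rkhs_constant_maps)
  obtain C where C: "\<And>h. norm (l h) \<le> norm h * C"
    using l.bounded by blast
  show ?thesis
  proof (rule Riesz_representation[of "\<lambda>F. l (F 0)" C])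
    show "\<bar>l (F 0)\<bar> \<le> C * sqrt (F 0 \<bullet> F 0)" for F :: "'h \<Rightarrow> 'h"
      using C[of "F 0"] by (simp add: norm_eq_sqrt_inner mult.commute)
  next
    fix R :: "'h \<Rightarrow> 'h"
    assume R: "\<And>F::'h \<Rightarrow> 'h. F \<in> range (\<lambda>a x. a) \<Longrightarrow> R 0 \<bullet> F 0 = l (F 0)"
    show thesis
      using R[of "\<lambda>x. h" for h] by (intro that[of "R 0"]) simp
  qed (simp_all add: l.add l.scaleR)
qed

section \<open>The \<open>L\<^sup>2\<close> form on \<open>H\<close>\<close>

context L2_function_space
begin

text \<open>The form polarizing the squared \<open>L2_norm\<close>. It may vanish on the diagonal at
  nonzero elements, so it is only positive semidefinite.\<close>

definition L2_inner :: "'h \<Rightarrow> 'h \<Rightarrow> real" where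
  "L2_inner f g = (\<integral>t. rep f t * rep g t \<partial>lebesgue_on {0..1})"

lemma rep_measurable [measurable]: "rep f \<in> borel_measurable (lebesgue_on {0..1})"
  using rep_square_integrable unfolding square_integrable_def by blast

lemma integrable_rep_mult: "integrable (lebesgue_on {0..1}) (\<lambda>t. rep f t * rep g t)"
proof (rule Bochner_Integration.integrable_bound)
  show "integrable (lebesgue_on {0..1}) (\<lambda>t. (rep f t)\<^sup>2 + (rep g t)\<^sup>2)"
    using rep_square_integrable unfolding square_integrable_def by simp
  have "\<bar>a * b\<bar> \<le> a\<^sup>2 + b\<^sup>2" for a b :: real
  proof -
    have "2 * (\<bar>a\<bar> * \<bar>b\<bar>) \<le> a\<^sup>2 + b\<^sup>2"
      using sum_squares_bound[of "\<bar>a\<bar>" "\<bar>b\<bar>"] by simp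
    moreover have "0 \<le> \<bar>a\<bar> * \<bar>b\<bar>" by simp
    ultimately show ?thesis unfolding abs_mult by linarith
  qed
  then show "AE t in lebesgue_on {0..1}.
      norm (rep f t * rep g t) \<le> norm ((rep f t)\<^sup>2 + (rep g t)\<^sup>2)"
    by simp
qed simp

lemma L2_inner_commute: "L2_inner f g = L2_inner g f"
  unfolding L2_inner_def by (simp add: mult.commute)

lemma L2_inner_add_left: "L2_inner (f + g) h = L2_inner f h + L2_inner g h"
proof -
  have "L2_inner (f + g) h
        = (\<integral>t. rep f t * rep h t + rep g t * rep h t \<partial>lebesgue_on {0..1})"
    unfolding L2_inner_def
  \<comment> \<open>Addition is pointwise only almost everywhere, so the integrands may differ on a
    null set.\<close>
  proof (rule integral_cong_AE)
    show "AE t in lebesgue_on {0..1}.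
        rep (f + g) t * rep h t = rep f t * rep h t + rep g t * rep h t"
      using rep_add[of f g] by eventually_elim (simp add: distrib_right)
  qed simp_all
  then show ?thesis
    unfolding L2_inner_def by (simp add: integrable_rep_mult)
qed

lemma L2_inner_scaleR_left: "L2_inner (c *\<^sub>R f) h = c * L2_inner f h"
proof -
  have "L2_inner (c *\<^sub>R f) h = (\<integral>t. c * (rep f t * rep h t) \<partial>lebesgue_on {0..1})"
    unfolding L2_inner_def
  proof (rule integral_cong_AE)
    show "AE t in lebesgue_on {0..1}. rep (c *\<^sub>R f) t * rep h t = c * (rep f t * rep h t)"
      using rep_scaleR[of c f] by eventually_elim simp
  qed simp_all
  then show ?thesis
    unfolding L2_inner_def by simp
qed

lemma L2_inner_diff_left: "L2_inner (f - g) h = L2_inner f h - L2_inner g h"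
  using L2_inner_add_left[of f "- 1 *\<^sub>R g" h] L2_inner_scaleR_left[of "- 1" g h] by simp

lemma L2_inner_add_right: "L2_inner h (f + g) = L2_inner h f + L2_inner h g"
  by (simp add: L2_inner_commute[of h] L2_inner_add_left)

lemma L2_inner_scaleR_right: "L2_inner h (c *\<^sub>R f) = c * L2_inner h f"
  by (simp add: L2_inner_commute[of h] L2_inner_scaleR_left)

lemma L2_inner_diff_right: "L2_inner h (f - g) = L2_inner h f - L2_inner h g"
  by (simp add: L2_inner_commute[of h] L2_inner_diff_left)

lemma L2_inner_nonneg: "0 \<le> L2_inner f f"
  unfolding L2_inner_def by simp

lemma L2_norm_rep: "(L2_norm (rep f))\<^sup>2 = L2_inner f f"
  unfolding L2_norm_def L2_inner_def power2_eq_square by simp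

text \<open>Continuity of the inclusion bounds the diagonal, and Cauchy-Schwarz for the semidefinite
  form carries the bound to all pairs, with \<open>M = C\<^sup>2\<close>.\<close>

lemma L2_inner_bounded:
  obtains M where "0 \<le> M" "\<And>f g. \<bar>L2_inner f g\<bar> \<le> M * norm f * norm g"
proof -
  obtain C where C: "\<And>f. L2_norm (rep f) \<le> C * norm f"
    using rep_continuous by blast
  have self: "L2_inner f f \<le> (C * norm f)\<^sup>2" for f
  proof -
    have "0 \<le> L2_norm (rep f)" unfolding L2_norm_def by simp
    with C[of f] show ?thesis unfolding L2_norm_rep[symmetric] by (intro power_mono)
  qed
  have "\<bar>L2_inner f g\<bar> \<le> C\<^sup>2 * norm f * norm g" for f g
  proof -
    have "L2_inner (f + t *\<^sub>R g) (f + t *\<^sub>R g)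
          = L2_inner g g * t\<^sup>2 + 2 * L2_inner f g * t + L2_inner f f" for t
      by (simp add: L2_inner_add_left L2_inner_add_right L2_inner_scaleR_left
          L2_inner_scaleR_right L2_inner_commute[of g f] power2_eq_square algebra_simps)
    then have "0 \<le> L2_inner g g * t\<^sup>2 + 2 * L2_inner f g * t + L2_inner f f" for t
      using L2_inner_nonneg[of "f + t *\<^sub>R g"] by simp
    then have "(L2_inner f g)\<^sup>2 \<le> L2_inner g g * L2_inner f f"
      by (intro nonneg_quadratic_discriminant L2_inner_nonneg)
    also have "\<dots> \<le> (C * norm g)\<^sup>2 * (C * norm f)\<^sup>2"
      by (intro mult_mono self L2_inner_nonneg) simp
    also have "\<dots> = (C\<^sup>2 * norm f * norm g)\<^sup>2"
      by (simp add: power2_eq_square)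
    finally show ?thesis
      by (metis abs_le_square_iff abs_of_nonneg mult_nonneg_nonneg norm_ge_zero zero_le_power2)
  qed
  then show ?thesis
    using that[of "C\<^sup>2"] by simp
qed

text \<open>Lets \<open>Riesz_representation_inner\<close> turn an \<open>L\<^sup>2\<close> pairing
  into the inner product of \<open>'h\<close>, which may be a different one.\<close>

lemma bounded_linear_L2_inner: "bounded_linear (L2_inner f)"
proof -
  obtain M where "\<And>f g. \<bar>L2_inner f g\<bar> \<le> M * norm f * norm g"
    by (rule L2_inner_bounded) blast
  then show ?thesis
    by (intro bounded_linear_intro[of _ "M * norm f"])
       (simp_all add: L2_inner_add_right L2_inner_scaleR_right mult.commute[of "norm _" "M * norm f"])
qed

end

section \<open>The regularized inner product and its completeness\<close>

locale regularized_regression = L2_function_space rep + functional_rkhs V ip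
  for rep :: "'h::{real_inner, complete_space} \<Rightarrow> real \<Rightarrow> real"
    and V :: "('h \<Rightarrow> 'h) set" and ip +
  fixes n :: nat and x y :: "nat \<Rightarrow> 'h" and lam :: real
  assumes lam_pos: "0 < lam"
begin

definition reg_ip :: "('h \<Rightarrow> 'h) \<Rightarrow> ('h \<Rightarrow> 'h) \<Rightarrow> real" where
  "reg_ip F G = (\<Sum>i=1..n. L2_inner (F (x i)) (G (x i))) + lam * ip F G"

lemma lam_ip_le_reg_ip: "lam * ip F F \<le> reg_ip F F"
  unfolding reg_ip_def by (simp add: sum_nonneg L2_inner_nonneg)

text \<open>One half of the norm equivalence: it makes \<open>reg_ip\<close>-Cauchy sequences Cauchy
  for \<open>ip\<close> and carries evaluation bounds to \<open>reg_ip\<close>.\<close>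

lemma sqrt_ip_le_sqrt_reg_ip: "sqrt (ip F F) \<le> sqrt (reg_ip F F) / sqrt lam"
proof -
  have "sqrt (ip F F) * sqrt lam \<le> sqrt (reg_ip F F)"
    using lam_ip_le_reg_ip[of F] by (simp add: real_sqrt_mult[symmetric] mult.commute)
  then show ?thesis using lam_pos by (simp add: pos_le_divide_eq)
qed

text \<open>The other half: bounded evaluation at each \<open>x i\<close> controls the data terms.
  Limits for \<open>ip\<close> thereby become limits for \<open>reg_ip\<close>.\<close>

lemma reg_ip_bounded:
  obtains D where "0 \<le> D" "\<And>F. F \<in> V \<Longrightarrow> reg_ip F F \<le> D * ip F F"
proof -
  obtain M where M: "0 \<le> M" "\<And>f g. \<bar>L2_inner f g\<bar> \<le> M * norm f * norm g"
    by (rule L2_inner_bounded) blast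
  obtain C where C: "\<And>z F. F \<in> V \<Longrightarrow> norm (F z) \<le> C z * sqrt (ip F F)"
    using eval_bounded by metis
  have "L2_inner (F z) (F z) \<le> M * (C z)\<^sup>2 * ip F F" if F: "F \<in> V" for F z
  proof -
    have "L2_inner (F z) (F z) \<le> M * (norm (F z))\<^sup>2"
      using M(2)[of "F z" "F z"] by (simp add: power2_eq_square mult_ac)
    also have "\<dots> \<le> M * (C z * sqrt (ip F F))\<^sup>2"
      using C[OF F, of z] M(1) by (intro mult_left_mono power_mono) simp_all
    also have "\<dots> = M * (C z)\<^sup>2 * ip F F"
      using ip_nonneg[OF F] by (simp add: power_mult_distrib)
    finally show ?thesis .
  qed
  then have "reg_ip F F \<le> ((\<Sum>i=1..n. M * (C (x i))\<^sup>2) + lam) * ip F F" if "F \<in> V" for F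
    unfolding reg_ip_def distrib_right sum_distrib_right using that
    by (intro add_mono sum_mono) simp_all
  moreover have "0 \<le> (\<Sum>i=1..n. M * (C (x i))\<^sup>2) + lam"
    using M(1) lam_pos by (intro add_nonneg_nonneg sum_nonneg) simp_all
  ultimately show ?thesis using that by blast
qed

text \<open>By equivalence of the norms, completeness and bounded evaluation pass from
  \<open>ip\<close> to \<open>reg_ip\<close>; definiteness comes from the term
  \<open>lam * ip\<close>. Riesz representation then applies to \<open>reg_ip\<close>.\<close>

lemma functional_rkhs_reg_ip: "functional_rkhs V reg_ip"
proof
  show "reg_ip F G = reg_ip G F" if "F \<in> V" "G \<in> V" for F G
    unfolding reg_ip_def using that by (simp add: L2_inner_commute ip_commute)
  show "reg_ip (\<lambda>x. F x + G x) E = reg_ip F E + reg_ip G E"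
    if "F \<in> V" "G \<in> V" "E \<in> V" for F G E
    unfolding reg_ip_def using that
    by (simp add: L2_inner_add_left ip_add_left sum.distrib algebra_simps)
  show "reg_ip (\<lambda>x. c *\<^sub>R F x) G = c * reg_ip F G" if "F \<in> V" "G \<in> V" for F G c
    unfolding reg_ip_def using that
    by (simp add: L2_inner_scaleR_left ip_scaleR_left sum_distrib_left algebra_simps)
  show nonneg: "0 \<le> reg_ip F F" if "F \<in> V" for F
    using lam_ip_le_reg_ip[of F] ip_nonneg[OF that] lam_pos
    by (smt (verit) mult_nonneg_nonneg)
  show "F = (\<lambda>x. 0)" if "F \<in> V" "reg_ip F F = 0" for F
    using that lam_ip_le_reg_ip[of F] ip_nonneg[of F] lam_pos
    by (intro ip_eq_zero) (simp_all add: mult_le_0_iff)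
  show "\<exists>C. \<forall>F\<in>V. norm (F z) \<le> C * sqrt (reg_ip F F)" for z
  proof -
    obtain C where C: "\<forall>F\<in>V. norm (F z) \<le> C * sqrt (ip F F)"
      using eval_bounded by blast
    have "norm (F z) \<le> \<bar>C\<bar> / sqrt lam * sqrt (reg_ip F F)" if F: "F \<in> V" for F
    proof -
      have "norm (F z) \<le> C * sqrt (ip F F)" using C F by blast
      also have "\<dots> \<le> \<bar>C\<bar> * sqrt (ip F F)"
        using ip_nonneg[OF F] by (intro mult_right_mono) simp_all
      also have "\<dots> \<le> \<bar>C\<bar> * (sqrt (reg_ip F F) / sqrt lam)"
        by (intro mult_left_mono sqrt_ip_le_sqrt_reg_ip) simp
      finally show ?thesis by simp
    qed
    then show ?thesis by blast
  qed
  fix X :: "nat \<Rightarrow> 'h \<Rightarrow> 'h"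
  assume X: "\<And>k. X k \<in> V"
    and Cauchy: "\<And>e. 0 < e \<Longrightarrow> \<exists>N. \<forall>j\<ge>N. \<forall>k\<ge>N.
        sqrt (reg_ip (\<lambda>x. X j x - X k x) (\<lambda>x. X j x - X k x)) < e"
  have "\<exists>F\<in>V. (\<lambda>k. sqrt (ip (\<lambda>x. X k x - F x) (\<lambda>x. X k x - F x))) \<longlonglongrightarrow> 0"
  proof (rule complete[OF X])
    fix e :: real assume "0 < e"
    \<comment> \<open>This tolerance offsets the division by \<open>sqrt lam\<close> in
      \<open>sqrt_ip_le_sqrt_reg_ip\<close>.\<close>
    then have "0 < e * sqrt lam" using lam_pos by simp
    from Cauchy[OF this] obtain N where N: "\<And>j k. N \<le> j \<Longrightarrow> N \<le> k \<Longrightarrow>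
        sqrt (reg_ip (\<lambda>x. X j x - X k x) (\<lambda>x. X j x - X k x)) < e * sqrt lam" by blast
    have "sqrt (ip (\<lambda>x. X j x - X k x) (\<lambda>x. X j x - X k x)) < e" if "N \<le> j" "N \<le> k" for j k
    proof (rule le_less_trans[OF sqrt_ip_le_sqrt_reg_ip])
      show "sqrt (reg_ip (\<lambda>x. X j x - X k x) (\<lambda>x. X j x - X k x)) / sqrt lam < e"
        using N[OF that] lam_pos by (simp add: divide_less_eq)
    qed
    then show "\<exists>N. \<forall>j\<ge>N. \<forall>k\<ge>N. sqrt (ip (\<lambda>x. X j x - X k x) (\<lambda>x. X j x - X k x)) < e"
      by blast
  qed
  then obtain F where F: "F \<in> V"
    and lim: "(\<lambda>k. sqrt (ip (\<lambda>x. X k x - F x) (\<lambda>x. X k x - F x))) \<longlonglongrightarrow> 0" by blast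
  obtain D where D: "0 \<le> D" "\<And>F. F \<in> V \<Longrightarrow> reg_ip F F \<le> D * ip F F"
    by (rule reg_ip_bounded) blast
  have diff: "(\<lambda>x. X k x - F x) \<in> V" for k
    by (intro diff_mem X F)
  have "(\<lambda>k. sqrt (reg_ip (\<lambda>x. X k x - F x) (\<lambda>x. X k x - F x))) \<longlonglongrightarrow> 0"
  proof (rule Lim_null_comparison)
    show "\<forall>\<^sub>F k in sequentially. norm (sqrt (reg_ip (\<lambda>x. X k x - F x) (\<lambda>x. X k x - F x)))
        \<le> sqrt D * sqrt (ip (\<lambda>x. X k x - F x) (\<lambda>x. X k x - F x))"
      using D(2)[OF diff] nonneg[OF diff]
      by (intro always_eventually allI) (simp add: real_sqrt_mult[symmetric])
    show "(\<lambda>k. sqrt D * sqrt (ip (\<lambda>x. X k x - F x) (\<lambda>x. X k x - F x))) \<longlonglongrightarrow> 0"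
      using lim by (rule tendsto_mult_right_zero)
  qed
  with F show "\<exists>F\<in>V. (\<lambda>k. sqrt (reg_ip (\<lambda>x. X k x - F x) (\<lambda>x. X k x - F x))) \<longlonglongrightarrow> 0"
    by blast
qed (simp_all add: zero_mem add_mem scaleR_mem)

section \<open>Normal equations and minimizers\<close>

lemma normal_equations_solvable:
  obtains F where "F \<in> V" "\<And>G. G \<in> V \<Longrightarrow> reg_ip F G = (\<Sum>i=1..n. L2_inner (y i) (G (x i)))"
proof -
  interpret reg: functional_rkhs V reg_ip by (rule functional_rkhs_reg_ip)
  obtain M where M: "0 \<le> M" "\<And>f g. \<bar>L2_inner f g\<bar> \<le> M * norm f * norm g"
    by (rule L2_inner_bounded) blast
  obtain C where C: "\<And>z G. G \<in> V \<Longrightarrow> norm (G z) \<le> C z * sqrt (reg_ip G G)"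
    using reg.eval_bounded by metis
  show ?thesis
  proof (rule reg.Riesz_representation[of "\<lambda>G. \<Sum>i=1..n. L2_inner (y i) (G (x i))"
        "\<Sum>i=1..n. M * norm (y i) * C (x i)"])
    fix G assume G: "G \<in> V"
    have "\<bar>\<Sum>i=1..n. L2_inner (y i) (G (x i))\<bar>
          \<le> (\<Sum>i=1..n. M * norm (y i) * (C (x i) * sqrt (reg_ip G G)))"
    proof (rule order_trans[OF sum_abs], rule sum_mono)
      fix i
      have "\<bar>L2_inner (y i) (G (x i))\<bar> \<le> M * norm (y i) * norm (G (x i))" by (rule M)
      also have "\<dots> \<le> M * norm (y i) * (C (x i) * sqrt (reg_ip G G))"
        using M(1) C[OF G] by (intro mult_left_mono) simp_all
      finally show "\<bar>L2_inner (y i) (G (x i))\<bar>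
          \<le> M * norm (y i) * (C (x i) * sqrt (reg_ip G G))" .
    qed
    then show "\<bar>\<Sum>i=1..n. L2_inner (y i) (G (x i))\<bar>
        \<le> (\<Sum>i=1..n. M * norm (y i) * C (x i)) * sqrt (reg_ip G G)"
      unfolding sum_distrib_right by (simp only: mult.assoc)
  next
    fix R assume "R \<in> V" "\<And>F. F \<in> V \<Longrightarrow> reg_ip R F = (\<Sum>i=1..n. L2_inner (y i) (F (x i)))"
    then show thesis by (rule that)
  qed (simp_all add: L2_inner_add_right L2_inner_scaleR_right sum.distrib sum_distrib_left)
qed

text \<open>Expanding the squares merges the quadratic data terms with the penalty into
  \<open>reg_ip F F\<close>; the rest is constant or linear in \<open>F\<close>.\<close>

lemma objective_eq:
  assumes "F \<in> V"
  shows "objective rep ip n x y lam F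
         = (\<Sum>i=1..n. L2_inner (y i) (y i)) - 2 * (\<Sum>i=1..n. L2_inner (y i) (F (x i))) + reg_ip F F"
proof -
  have "L2_inner (y i - F (x i)) (y i - F (x i)) = L2_inner (y i) (y i)
        - 2 * L2_inner (y i) (F (x i)) + L2_inner (F (x i)) (F (x i))" for i
    by (simp add: L2_inner_diff_left L2_inner_diff_right L2_inner_commute[of "F (x i)" "y i"])
  then show ?thesis
    unfolding objective_def L2_norm_rep reg_ip_def using ip_nonneg[OF assms]
    by (simp add: sum.distrib sum_subtractf sum_distrib_left)
qed

text \<open>The normal equations turn the linear terms at \<open>F\<close> and \<open>G\<close> into
  \<open>reg_ip F F\<close> and \<open>reg_ip F G\<close>, which completes the square around
  \<open>F\<close>.\<close>

lemma objective_expand_at_solution: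
  assumes F: "F \<in> V" and normal: "\<And>G. G \<in> V \<Longrightarrow> reg_ip F G = (\<Sum>i=1..n. L2_inner (y i) (G (x i)))"
    and G: "G \<in> V"
  shows "objective rep ip n x y lam G
         = objective rep ip n x y lam F + reg_ip (\<lambda>z. G z - F z) (\<lambda>z. G z - F z)"
proof -
  interpret reg: functional_rkhs V reg_ip by (rule functional_rkhs_reg_ip)
  show ?thesis
    unfolding objective_eq[OF F] objective_eq[OF G] normal[OF F, symmetric] normal[OF G, symmetric]
      reg.ip_diff_self[OF G F] by simp
qed

text \<open>The excess of the objective over its value at \<open>F\<close> is a squared
  \<open>reg_ip\<close> norm, hence nonnegative and zero only at \<open>F\<close>.\<close>

lemma is_arg_min_objective_iff:
  assumes F: "F \<in> V" and normal: "\<And>G. G \<in> V \<Longrightarrow> reg_ip F G = (\<Sum>i=1..n. L2_inner (y i) (G (x i)))"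
  shows "is_arg_min (objective rep ip n x y lam) (\<lambda>F. F \<in> V) G \<longleftrightarrow> G = F"
proof -
  interpret reg: functional_rkhs V reg_ip by (rule functional_rkhs_reg_ip)
  note expand = objective_expand_at_solution[OF F normal]
  show ?thesis
  proof
    assume min: "is_arg_min (objective rep ip n x y lam) (\<lambda>F. F \<in> V) G"
    then have G: "G \<in> V" and "objective rep ip n x y lam G \<le> objective rep ip n x y lam F"
      using F unfolding is_arg_min_linorder by simp_all
    then have "reg_ip (\<lambda>z. G z - F z) (\<lambda>z. G z - F z) = 0"
      using expand[OF _ G] reg.ip_nonneg[OF diff_mem[OF G F]] by simp
    then have "(\<lambda>z. G z - F z) = (\<lambda>z. 0)"
      using F G by (intro reg.ip_eq_zero diff_mem)
    then show "G = F" by (metis eq_iff_diff_eq_0 ext)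
  next
    assume "G = F"
    moreover have "objective rep ip n x y lam F \<le> objective rep ip n x y lam H" if "H \<in> V" for H
      using expand[OF _ that] reg.ip_nonneg[OF diff_mem[OF that F]] by simp
    ultimately show "is_arg_min (objective rep ip n x y lam) (\<lambda>F. F \<in> V) G"
      using F unfolding is_arg_min_linorder by simp
  qed
qed

section \<open>Kernel expansion of the minimizer\<close>

lemma normal_equations_representation:
  assumes F: "F \<in> V" and normal: "\<And>G. G \<in> V \<Longrightarrow> reg_ip F G = (\<Sum>i=1..n. L2_inner (y i) (G (x i)))"
  obtains \<alpha> where "F = (\<lambda>z. \<Sum>i=1..n. reproducing_kernel V ip (x i) z (\<alpha> i))"
proof -
  \<comment> \<open>Each residual defines a bounded functional through the form; its representer in
    \<open>'h\<close> is the coefficient up to scaling.\<close>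
  have "\<exists>a. \<forall>h. L2_inner (y i - F (x i)) h = a \<bullet> h" for i
    using Riesz_representation_inner[OF bounded_linear_L2_inner] by metis
  then obtain a where a: "\<And>i h. L2_inner (y i - F (x i)) h = a i \<bullet> h" by metis
  \<comment> \<open>The factor \<open>1 / lam\<close> undoes the weight of \<open>ip\<close> in
    \<open>reg_ip\<close>.\<close>
  let ?K = "\<lambda>i z. reproducing_kernel V ip (x i) z ((1 / lam) *\<^sub>R a i)"
  have "F = (\<lambda>z. \<Sum>i=1..n. ?K i z)"
  proof (rule ip_ext[OF F])
    show "(\<lambda>z. \<Sum>i=1..n. ?K i z) \<in> V"
      by (intro sum_mem reproducing_kernel_mem) simp
    fix G assume G: "G \<in> V"
    have "lam * ip F G = (\<Sum>i=1..n. L2_inner (y i - F (x i)) (G (x i)))"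
      using normal[OF G] unfolding reg_ip_def by (simp add: L2_inner_diff_left sum_subtractf)
    also have "\<dots> = lam * (\<Sum>i=1..n. ip (?K i) G)"
      unfolding sum_distrib_left
      using lam_pos by (simp add: a ip_reproducing_kernel G inner_commute[of "a _"])
    also have "\<dots> = lam * ip (\<lambda>z. \<Sum>i=1..n. ?K i z) G"
      by (subst ip_sum_left) (simp_all add: reproducing_kernel_mem G)
    finally show "ip F G = ip (\<lambda>z. \<Sum>i=1..n. ?K i z) G" using lam_pos by simp
  qed
  then show ?thesis by (rule that)
qed

end

theorem theorem1:
  fixes rep :: "'h::{real_inner, complete_space} \<Rightarrow> real \<Rightarrow> real"
    and V :: "('h \<Rightarrow> 'h) set"
    and ip :: "('h \<Rightarrow> 'h) \<Rightarrow> ('h \<Rightarrow> 'h) \<Rightarrow> real"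
    and K :: "'h \<Rightarrow> 'h \<Rightarrow> 'h \<Rightarrow> 'h"
    and n :: nat
    and x y :: "nat \<Rightarrow> 'h"
    and lam :: real
  assumes "L2_function_space rep"
    and "functional_rkhs V ip"
    and "K = reproducing_kernel V ip"
    and "lam > 0"
  shows "(\<exists>!F. is_arg_min (objective rep ip n x y lam) (\<lambda>F. F \<in> V) F) \<and>
         (\<forall>F. is_arg_min (objective rep ip n x y lam) (\<lambda>F. F \<in> V) F \<longrightarrow>
              (\<exists>\<alpha> :: nat \<Rightarrow> 'h. F = (\<lambda>z. \<Sum>i=1..n. K (x i) z (\<alpha> i))))"
proof -
  interpret regularized_regression rep V ip n x y lam
    using assms by (intro regularized_regression.intro regularized_regression_axioms.intro)
  obtain F where F: "F \<in> V"
    and normal: "\<And>G. G \<in> V \<Longrightarrow> reg_ip F G = (\<Sum>i=1..n. L2_inner (y i) (G (x i)))"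
    by (rule normal_equations_solvable) blast
  \<comment> \<open>As \<open>F\<close> is the only minimizer, unique existence and representation
    both reduce to this one map.\<close>
  have iff: "is_arg_min (objective rep ip n x y lam) (\<lambda>F. F \<in> V) G \<longleftrightarrow> G = F" for G
    using F normal by (rule is_arg_min_objective_iff)
  obtain \<alpha> where "F = (\<lambda>z. \<Sum>i=1..n. reproducing_kernel V ip (x i) z (\<alpha> i))"
    by (rule normal_equations_representation[OF F normal])
  then have "\<exists>\<alpha>. F = (\<lambda>z. \<Sum>i=1..n. K (x i) z (\<alpha> i))"
    unfolding assms(3) by (rule exI[of _ \<alpha>])
  then show ?thesis unfolding iff by blast
qed

end
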